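(* Let $n\ge 2$ with $n\equiv 0\pmod 4$. Then the number of equiparity Latin squares in the ensemble of any $\mathrm{OA}(n+1,n)$ is even and at least $n(n+1)(n-4)/24$.
   Context: An orthogonal array $\mathrm{OA}(k,n)$ on an alphabet $\Lambda$ with $|\Lambda|=n$ is an $n^2\times k$ matrix $A=(a_{r\ell})$ with entries in $\Lambda$ such that in every pair of distinct columns each ordered pair in $\Lambda^2$ occurs in exactly one row. The ensemble of $A$ is the family of Latin squares indexed by the $\binom{k}{3}$ choices of columns $i<j<\ell$ of $A$ (Latin squares are counted once for each choice of three columns): the Latin square for $i<j<\ell$ has rows and columns indexed by $\Lambda$, and for each row $r$ of $A$ its entry in row $a_{ri}$, column $a_{rj}$ is $a_{r\ell}$. For a Latin square $L=(l_{xy})$ with rows, columns and symbols indexed by $\Lambda$, the row-parity $\pi_r\in\mathbb{Z}_2$ is the sum of the parities ($0$ even, $1$ odd) of the $n$ permutations $y\mapsto l_{xy}$ ($x\in\Lambda$ fixed); the column-parity $\pi_c$ is the sum of the parities of the $n$ permutations $x\mapsto l_{xy}$ ($y$ fixed); the symbol-parity $\pi_s$ is the sum of the parities of the $n$ permutations mapping $x\mapsto y$ whenever $l_{xy}=s$ ($s$ fixed). $L$ is equiparity if $\pi_r=\pi_c=\pi_s$. *)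

theory Defs
  imports
    "Jordan_Normal_Form.Matrix"
    "HOL-Combinatorics.Permutations"
    "HOL-Library.Z2"
    "HOL-Number_Theory.Cong"
begin

definition orthogonal_array :: "nat \<Rightarrow> nat \<Rightarrow> 'a set \<Rightarrow> 'a mat \<Rightarrow> bool" where
  "orthogonal_array k n \<Lambda> A \<longleftrightarrow>
     finite \<Lambda> \<and> card \<Lambda> = n \<and>
     A \<in> carrier_mat (n\<^sup>2) k \<and>
     (\<forall>r<n\<^sup>2. \<forall>l<k. A $$ (r, l) \<in> \<Lambda>) \<and>
     (\<forall>i<k. \<forall>j<k. i \<noteq> j \<longrightarrow>
        (\<forall>x\<in>\<Lambda>. \<forall>y\<in>\<Lambda>. \<exists>!r. r < n\<^sup>2 \<and> A $$ (r, i) = x \<and> A $$ (r, j) = y))"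

text \<open>
  A square with rows, columns and symbols indexed by \<open>\<Lambda>\<close> is a binary function \<open>L\<close>, of which
  only the values on \<open>\<Lambda>\<close> matter; \<open>L x y\<close> is the entry in row \<open>x\<close> and column \<open>y\<close>.
\<close>

definition latin_square :: "'a set \<Rightarrow> ('a \<Rightarrow> 'a \<Rightarrow> 'a) \<Rightarrow> bool" where
  "latin_square \<Lambda> L \<longleftrightarrow>
     (\<forall>x\<in>\<Lambda>. bij_betw (\<lambda>y. L x y) \<Lambda> \<Lambda>) \<and> (\<forall>y\<in>\<Lambda>. bij_betw (\<lambda>x. L x y) \<Lambda> \<Lambda>)"

text \<open>
  The library's \<^const>\<open>evenperm\<close> is about permutations of a whole type, so a permutation of
  \<open>\<Lambda>\<close> is first extended by the identity outside \<open>\<Lambda>\<close>.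
\<close>

definition perm_parity :: "'a set \<Rightarrow> ('a \<Rightarrow> 'a) \<Rightarrow> bit" where
  "perm_parity \<Lambda> f = (if evenperm (restrict_id f \<Lambda>) then 0 else 1)"

definition row_parity :: "'a set \<Rightarrow> ('a \<Rightarrow> 'a \<Rightarrow> 'a) \<Rightarrow> bit" where
  "row_parity \<Lambda> L = (\<Sum>x\<in>\<Lambda>. perm_parity \<Lambda> (\<lambda>y. L x y))"

definition column_parity :: "'a set \<Rightarrow> ('a \<Rightarrow> 'a \<Rightarrow> 'a) \<Rightarrow> bit" where
  "column_parity \<Lambda> L = (\<Sum>y\<in>\<Lambda>. perm_parity \<Lambda> (\<lambda>x. L x y))"

definition symbol_parity :: "'a set \<Rightarrow> ('a \<Rightarrow> 'a \<Rightarrow> 'a) \<Rightarrow> bit" where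
  "symbol_parity \<Lambda> L = (\<Sum>s\<in>\<Lambda>. perm_parity \<Lambda> (\<lambda>x. THE y. y \<in> \<Lambda> \<and> L x y = s))"

definition equiparity :: "'a set \<Rightarrow> ('a \<Rightarrow> 'a \<Rightarrow> 'a) \<Rightarrow> bool" where
  "equiparity \<Lambda> L \<longleftrightarrow>
     row_parity \<Lambda> L = column_parity \<Lambda> L \<and> column_parity \<Lambda> L = symbol_parity \<Lambda> L"

text \<open>Columns are numbered from \<open>0\<close>.\<close>

definition column_triples :: "nat \<Rightarrow> (nat \<times> nat \<times> nat) set" where
  "column_triples k = {(i, j, l). i < j \<and> j < l \<and> l < k}"

text \<open>
  The ensemble of an array with \<open>k\<close> columns is the family \<open>ensemble A\<close> indexed by
  \<open>column_triples k\<close>.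
\<close>

definition ensemble :: "'a mat \<Rightarrow> nat \<times> nat \<times> nat \<Rightarrow> 'a \<Rightarrow> 'a \<Rightarrow> 'a" where
  "ensemble A = (\<lambda>(i, j, l) x y.
     A $$ (THE r. r < dim_row A \<and> A $$ (r, i) = x \<and> A $$ (r, j) = y, l))"

lemma ensemble_entry:
  assumes A: "orthogonal_array k n \<Lambda> A" and "(i, j, l) \<in> column_triples k" and r: "r < n\<^sup>2"
  shows "ensemble A (i, j, l) (A $$ (r, i)) (A $$ (r, j)) = A $$ (r, l)"
proof -
  have ij: "i < k" "j < k" "i \<noteq> j" and dim: "dim_row A = n\<^sup>2"
    using assms by (auto simp: column_triples_def orthogonal_array_def)
  have "A $$ (r, i) \<in> \<Lambda>" "A $$ (r, j) \<in> \<Lambda>"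
    using A ij r by (auto simp: orthogonal_array_def)
  then have "\<exists>!r'. r' < n\<^sup>2 \<and> A $$ (r', i) = A $$ (r, i) \<and> A $$ (r', j) = A $$ (r, j)"
    using A ij by (simp add: orthogonal_array_def)
  then have "(THE r'. r' < n\<^sup>2 \<and> A $$ (r', i) = A $$ (r, i) \<and> A $$ (r', j) = A $$ (r, j)) = r"
    using r by (intro the1_equality) auto
  then show ?thesis
    by (simp add: ensemble_def dim)
qed

lemma latin_square_ensemble:
  assumes A: "orthogonal_array k n \<Lambda> A" and t: "(i, j, l) \<in> column_triples k"
  shows "latin_square \<Lambda> (ensemble A (i, j, l))"
proof -
  let ?L = "ensemble A (i, j, l)"
  have k: "i < k" "j < k" "l < k" "i \<noteq> j" "i \<noteq> l" "j \<noteq> l" and fin: "finite \<Lambda>"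
    using A t by (auto simp: column_triples_def orthogonal_array_def)
  have mem: "A $$ (r, c) \<in> \<Lambda>" if "r < n\<^sup>2" "c < k" for r c
    using A that by (simp add: orthogonal_array_def)
  have ex: "\<exists>r<n\<^sup>2. A $$ (r, c) = x \<and> A $$ (r, d) = y"
    if "c < k" "d < k" "c \<noteq> d" "x \<in> \<Lambda>" "y \<in> \<Lambda>" for c d x y
    using A that unfolding orthogonal_array_def by blast
  have L: "?L (A $$ (r, i)) (A $$ (r, j)) = A $$ (r, l)" if "r < n\<^sup>2" for r
    by (rule ensemble_entry[OF A t that])
  have closed: "?L x y \<in> \<Lambda>" if "x \<in> \<Lambda>" "y \<in> \<Lambda>" for x y
    using ex[OF k(1,2,4) that] L mem k(3) by metis
  have row: "\<exists>y\<in>\<Lambda>. ?L x y = s" if "x \<in> \<Lambda>" "s \<in> \<Lambda>" for x s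
    using ex[OF k(1,3,5) that] L mem k(2) by metis
  have col: "\<exists>x\<in>\<Lambda>. ?L x y = s" if "y \<in> \<Lambda>" "s \<in> \<Lambda>" for y s
    using ex[OF k(2,3,6) that] L mem k(1) by metis
  have bij: "bij_betw f \<Lambda> \<Lambda>" if "\<And>x. x \<in> \<Lambda> \<Longrightarrow> f x \<in> \<Lambda>" "\<And>s. s \<in> \<Lambda> \<Longrightarrow> \<exists>x\<in>\<Lambda>. f x = s" for f
  proof -
    have "f ` \<Lambda> = \<Lambda>"
      using that by blast
    then show ?thesis
      using fin by (simp add: bij_betw_def finite_surj_inj)
  qed
  show ?thesis
    unfolding latin_square_def using closed row col by (auto intro!: bij)
qed

end

(*
  For columns i, j of the array let M i j in Z_2 be the parity of the permutation that sorts the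
  rows, given in a fixed order, lexicographically by (column i, column j).  Two such orders with the same leading column
  disagree exactly on the pairs of rows that agree in that column and are inverted in the second
  one, so the row-, column- and symbol-parities of the Latin square for i < j < l are
  M i j + M i l, M j i + M j l and M l i + M l j.  When 4 divides n, the number (n choose 2)^2
  of pairs of rows that two columns order oppositely is even, so M is symmetric, and a Latin
  square is equiparity iff its triangle is monochromatic in the graph M on the n + 1 columns.
  Two rows of an OA(n + 1, n) agree in exactly one column; hence all vertices of that graph have
  the same degree modulo 2, and as n + 1 is odd this is 0.  Goodman's formula counts the
  monochromatic triangles from the degrees d: twice the number of the others is the sum of
  d (n - d), in which every summand is a multiple of 4 and at most n^2 / 4.
*)
theory Submission
  imports Defs
begin

declare add_bit_eq_xor [simp del] mult_bit_eq_and [simp del]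

lemma bit_add_self: "x + x = (0 :: bit)"
  by (cases x) simp_all

section \<open>Parity of a permutation as the disagreement of two orders\<close>

definition ascents :: "'b set \<Rightarrow> ('b \<Rightarrow> nat) \<Rightarrow> ('b \<times> 'b) set" where
  "ascents S u = {(x, y) \<in> S \<times> S. u x < u y}"

text \<open>For injective \<open>u\<close> and \<open>v\<close> this is the relative sign of the two
  linear orders that they induce on \<open>S\<close>: every unordered pair on which they differ
  contributes once, listed in the order of \<open>u\<close>.\<close>

definition disagreement :: "'b set \<Rightarrow> ('b \<Rightarrow> nat) \<Rightarrow> ('b \<Rightarrow> nat) \<Rightarrow> bit" where
  "disagreement S u v = (\<Sum>(x, y)\<in>S \<times> S. of_bool (u x < u y \<and> v y < v x))"

lemma finite_ascents [simp]: "finite S \<Longrightarrow> finite (ascents S u)"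
  by (rule finite_subset[of _ "S \<times> S"]) (auto simp: ascents_def)

text \<open>Each unordered pair of distinct elements occurs in exactly one orientation in
  \<open>ascents S u\<close>, and likewise for \<open>v\<close>, so both sides sum a symmetric
  function over unordered pairs.\<close>

lemma sum_ascents_cong_order:
  fixes F :: "'b \<Rightarrow> 'b \<Rightarrow> 'c :: comm_monoid_add"
  assumes "finite S" "inj_on u S" "inj_on v S" and sym: "\<And>x y. F x y = F y x"
  shows "(\<Sum>(x, y)\<in>ascents S u. F x y) = (\<Sum>(x, y)\<in>ascents S v. F x y)"
proof -
  let ?f = "\<lambda>(x, y). if v x < v y then (x, y) else (y, x)"
  let ?g = "\<lambda>(x, y). if u x < u y then (x, y) else (y, x)"
  show ?thesis
    by (rule sum.reindex_bij_witness[where i = ?g and j = ?f])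
      (use assms in \<open>auto simp: ascents_def split: if_splits dest: inj_onD\<close>,
       (metis inj_onD linorder_neqE_nat less_irrefl)+)
qed

text \<open>The new summand is symmetric on distinct elements when \<open>u\<close> and
  \<open>v\<close> are injective, so \<open>sum_ascents_cong_order\<close> can then change the order
  that selects the pairs.\<close>

lemma disagreement_eq_sum_ascents:
  assumes "finite S" "inj_on v S"
  shows "disagreement S u v = (\<Sum>(x, y)\<in>ascents S u. of_bool ((u x < u y) \<noteq> (v x < v y)))"
proof -
  have "disagreement S u v = (\<Sum>(x, y)\<in>ascents S u. of_bool (u x < u y \<and> v y < v x))"
    unfolding disagreement_def
    by (rule sum.mono_neutral_right) (use assms in \<open>auto simp: ascents_def\<close>)
  also have "\<dots> = (\<Sum>(x, y)\<in>ascents S u. of_bool ((u x < u y) \<noteq> (v x < v y)))"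
  proof (rule sum.cong[OF refl])
    fix z assume "z \<in> ascents S u"
    moreover obtain x y where "z = (x, y)" by (cases z)
    ultimately have "z = (x, y)" "u x < u y" "v x \<noteq> v y"
      using assms by (auto simp: ascents_def dest: inj_onD)
    then show "(case z of (x, y) \<Rightarrow> of_bool (u x < u y \<and> v y < v x)) =
        ((case z of (x, y) \<Rightarrow> of_bool ((u x < u y) \<noteq> (v x < v y))) :: bit)"
      by auto
  qed
  finally show ?thesis .
qed

lemma disagreement_commute: "disagreement S u v = disagreement S v u"
  unfolding disagreement_def
  by (rule sum.reindex_bij_witness[where i = prod.swap and j = prod.swap]) (auto simp: conj_commute)

text \<open>On a single pair, \<open>u\<close> and \<open>w\<close> differ iff exactly one of the
  comparisons \<open>u\<close> with \<open>v\<close> and \<open>v\<close> with \<open>w\<close>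
  shows a difference; this is addition in Z_2, once all sums run over the ascents of
  \<open>u\<close>.\<close>

lemma disagreement_trans:
  assumes "finite S" "inj_on u S" "inj_on v S" "inj_on w S"
  shows "disagreement S u v + disagreement S v w = disagreement S u w"
proof -
  \<comment> \<open>Membership in \<open>S\<close> is built in because the symmetry is required for
    all arguments, while injectivity is known on \<open>S\<close> only.\<close>
  let ?F = "\<lambda>x y. of_bool ((v x < v y) \<noteq> (w x < w y) \<and> x \<in> S \<and> y \<in> S) :: bit"
  have sym: "?F x y = ?F y x" for x y
    using assms(3,4) by (cases "x = y") (auto dest: inj_onD simp: of_bool_def not_less_iff_gr_or_eq)
  have "disagreement S v w = (\<Sum>(x, y)\<in>ascents S v. ?F x y)"
    unfolding disagreement_eq_sum_ascents[OF assms(1,4)]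
    by (rule sum.cong) (auto simp: ascents_def)
  also have "\<dots> = (\<Sum>(x, y)\<in>ascents S u. ?F x y)"
    by (rule sum_ascents_cong_order) (use assms sym in auto)
  finally have "disagreement S u v + disagreement S v w =
      (\<Sum>(x, y)\<in>ascents S u. of_bool ((u x < u y) \<noteq> (v x < v y)) + ?F x y)"
    unfolding disagreement_eq_sum_ascents[OF assms(1,3)]
    by (simp add: sum.distrib[symmetric] case_prod_unfold)
  also have "\<dots> = disagreement S u w"
    unfolding disagreement_eq_sum_ascents[OF assms(1,4)]
    by (rule sum.cong) (auto simp: ascents_def of_bool_def)
  finally show ?thesis .
qed

lemma disagreement_self [simp]: "disagreement S u u = 0"
  by (auto simp: disagreement_def intro!: sum.neutral)

lemma disagreement_cong:
  "(\<And>x. x \<in> S \<Longrightarrow> u x = u' x) \<Longrightarrow> (\<And>x. x \<in> S \<Longrightarrow> v x = v' x) \<Longrightarrow>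
    disagreement S u v = disagreement S u' v'"
  unfolding disagreement_def by (rule sum.cong) auto

lemma disagreement_reindex:
  assumes "bij_betw q S T"
  shows "disagreement S (u \<circ> q) (v \<circ> q) = disagreement T u v"
proof -
  have "bij_betw (map_prod q q) (S \<times> S) (T \<times> T)"
    using bij_betw_map_prod[OF assms assms] by simp
  from sum.reindex_bij_betw[OF this, of "\<lambda>(x, y). of_bool (u x < u y \<and> v y < v x)"]
  show ?thesis by (simp add: disagreement_def case_prod_unfold)
qed

text \<open>If \<open>u a < u b\<close>, the inverted pairs are (a, b) together with (a, c) and (c,
  b) for every \<open>c\<close> strictly between, an odd number in total.\<close>

lemma disagreement_transpose:
  assumes S: "finite S" and u: "inj_on u S" and ab: "a \<in> S" "b \<in> S" "a \<noteq> b"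
  shows "disagreement S u (u \<circ> Transposition.transpose a b) = 1"
proof -
  have main: "disagreement S u (u \<circ> Transposition.transpose a b) = 1"
    if ab: "a \<in> S" "b \<in> S" "u a < u b" for a b
  proof -
    let ?t = "Transposition.transpose a b"
    define C where "C = {c \<in> S. u a < u c \<and> u c < u b}"
    let ?D = "{(x, y) \<in> S \<times> S. u x < u y \<and> u (?t y) < u (?t x)}"
    have eq: "?D = insert (a, b) (Pair a ` C \<union> (\<lambda>c. (c, b)) ` C)"
    proof (intro equalityI subsetI)
      fix z assume "z \<in> ?D"
      then obtain x y where z: "z = (x, y)" "x \<in> S" "y \<in> S" "u x < u y" "u (?t y) < u (?t x)"
        by auto
      show "z \<in> insert (a, b) (Pair a ` C \<union> (\<lambda>c. (c, b)) ` C)"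
        using z ab unfolding C_def Transposition.transpose_def by (auto split: if_splits)
    next
      fix z assume "z \<in> insert (a, b) (Pair a ` C \<union> (\<lambda>c. (c, b)) ` C)"
      then show "z \<in> ?D"
        using ab unfolding C_def Transposition.transpose_def by auto
    qed
    have fin: "finite C" using S by (simp add: C_def)
    have disj: "Pair a ` C \<inter> (\<lambda>c. (c, b)) ` C = {}" "(a, b) \<notin> Pair a ` C \<union> (\<lambda>c. (c, b)) ` C"
      by (auto simp: C_def)
    have "card ?D = Suc (card C + card C)"
      unfolding eq using fin disj by (simp add: card_Un_disjoint card_image inj_on_def)
    then have odd: "odd (card ?D)" by simp
    have "disagreement S u (u \<circ> ?t) = (\<Sum>z\<in>?D. 1)"
      unfolding disagreement_def
      by (rule sum.mono_neutral_cong_right) (use S in \<open>auto\<close>)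
    also have "\<dots> = of_nat (card ?D)" by simp
    finally show ?thesis using odd by (auto elim!: oddE)
  qed
  have "u a \<noteq> u b" using u ab by (auto dest: inj_onD)
  then consider "u a < u b" | "u b < u a" by linarith
  then show ?thesis
  proof cases
    case 2
    then show ?thesis using main[OF ab(2,1)] by (simp add: transpose_commute)
  qed (use main ab in blast)
qed

text \<open>Induction over products of transpositions: one more transposition flips both sides. The
  injection \<open>u\<close> is arbitrary, so any numbering of \<open>S\<close> may serve to count
  inversions.\<close>

lemma perm_parity_eq_disagreement:
  assumes S: "finite S" and u: "inj_on u S" and f: "bij_betw f S S"
  shows "perm_parity S f = disagreement S u (u \<circ> f)"
proof -
  have parity: "(if evenperm p then 0 else 1) = disagreement S u (u \<circ> p)" if "p permutes S" for p
    using that S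
  proof (induction rule: permutes_induct)
    case id
    then show ?case by simp
  next
    case (swap a b p)
    let ?t = "Transposition.transpose a b"
    have t: "?t permutes S" using swap by (simp add: permutes_swap_id)
    have inj: "inj_on (u \<circ> p) S" "inj_on (u \<circ> (?t \<circ> p)) S"
      using u t swap.hyps(4)
      by (metis comp_inj_on permutes_image permutes_inj_on permutes_compose)+
    have "disagreement S u (u \<circ> (?t \<circ> p)) =
        disagreement S u (u \<circ> p) + disagreement S (u \<circ> p) ((u \<circ> ?t) \<circ> p)"
      using disagreement_trans[OF S u inj] by (simp add: comp_assoc)
    \<comment> \<open>Reindexing along \<open>p\<close> reduces this to a single transposition
      compared with \<open>u\<close>.\<close>
    also have "disagreement S (u \<circ> p) ((u \<circ> ?t) \<circ> p) = 1"
      unfolding disagreement_reindex[OF permutes_imp_bij[OF swap.hyps(4)]]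
      by (rule disagreement_transpose[OF S u swap.hyps(1-3)])
    finally have d: "disagreement S u (u \<circ> (?t \<circ> p)) = disagreement S u (u \<circ> p) + 1" .
    have e: "evenperm (?t \<circ> p) \<longleftrightarrow> \<not> evenperm p"
      using swap S by (subst evenperm_comp)
        (auto simp: permutation_swap_id evenperm_swap intro: permutation_permutes[THEN iffD2])
    show ?case unfolding d e swap.IH[symmetric] by simp
  qed
  have "perm_parity S f = disagreement S u (u \<circ> restrict_id f S)"
    unfolding perm_parity_def by (intro parity permutes_restrict_id f)
  also have "\<dots> = disagreement S u (u \<circ> f)"
    by (rule disagreement_cong) auto
  finally show ?thesis .
qed

section \<open>The graph \<open>M\<close> on the columns of an orthogonal array\<close>

text \<open>The link between the two sides of the argument: modulo 2 its size is both a parity of a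
  Latin square and a sum of two values of \<open>M\<close>.\<close>

definition skew_pairs :: "'b set \<Rightarrow> ('b \<Rightarrow> nat) \<Rightarrow> ('b \<Rightarrow> nat) \<Rightarrow> ('b \<Rightarrow> nat) \<Rightarrow> ('b \<times> 'b) set" where
  "skew_pairs R a u v = {(r, s) \<in> R \<times> R. a r = a s \<and> u r < u s \<and> v s < v r}"

lemma finite_skew_pairs [simp]: "finite R \<Longrightarrow> finite (skew_pairs R a u v)"
  by (rule finite_subset[of _ "R \<times> R"]) (auto simp: skew_pairs_def)

lemma disagreement_eq_card:
  assumes "finite S"
  shows "disagreement S u v = of_nat (card {(x, y) \<in> S \<times> S. u x < u y \<and> v y < v x})"
proof -
  have "disagreement S u v = (\<Sum>z\<in>{(x, y) \<in> S \<times> S. u x < u y \<and> v y < v x}. 1)"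
    unfolding disagreement_def
    by (rule sum.mono_neutral_cong_right) (use assms in auto)
  then show ?thesis by simp
qed

lemma lex_less_iff:
  fixes n p q p' q' :: nat
  assumes "q < n" "q' < n"
  shows "n * p + q < n * p' + q' \<longleftrightarrow> p < p' \<or> p = p' \<and> q < q'"
proof -
  have less: "n * p + q < n * p' + q'" if "p < p'" "q < n" for p q p' q' :: nat
  proof -
    have "n * Suc p \<le> n * p'" using that by (intro mult_le_mono) auto
    then show ?thesis using that by simp
  qed
  show ?thesis
    using less[of p p' q q'] less[of p' p q' q] assms by (cases p p' rule: linorder_cases) auto
qed

lemma card_increasing_pairs: "2 * card {(x, y). x < y \<and> y < (n :: nat)} = n * (n - 1)"
proof -
  have "card {(x, y). x < y \<and> y < n} = card (Sigma {..<n} (\<lambda>y. {..<y}))"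
    by (rule bij_betw_same_card[of prod.swap])
      (auto simp: bij_betw_def inj_on_def image_def)
  also have "\<dots> = (\<Sum>y<n. y)" by simp
  also have "2 * (\<Sum>y<n. y) = n * (n - 1)"
    by (induction n) (auto simp: algebra_simps diff_mult_distrib2)
  finally show ?thesis .
qed

lemma even_card_increasing_pairs:
  assumes "4 dvd n"
  shows "even (card {(x, y). x < y \<and> y < (n :: nat)})"
proof -
  obtain m where "n = 4 * m" using assms by auto
  then have "card {(x, y). x < y \<and> y < n} = 2 * (m * (n - 1))"
    using card_increasing_pairs[of n] by simp
  then show ?thesis by simp
qed

text \<open>An OA(n + 1, n) with columns 0 to n whose symbols are renamed to the numbers below
  \<open>n\<close>, so that rows can be compared by their entries.\<close>

locale column_array =
  fixes n :: nat and R :: "'b set" and a :: "nat \<Rightarrow> 'b \<Rightarrow> nat"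
  assumes finite_rows: "finite R" and four_dvd: "4 dvd n"
    and bij: "i \<le> n \<Longrightarrow> j \<le> n \<Longrightarrow> i \<noteq> j \<Longrightarrow>
      bij_betw (\<lambda>r. (a i r, a j r)) R ({..<n} \<times> {..<n})"
    and range_less: "i \<le> n \<Longrightarrow> r \<in> R \<Longrightarrow> a i r < n"
begin

text \<open>A two-digit number in base \<open>n\<close>, so that comparing keys is comparing
  lexicographically.\<close>

abbreviation key :: "nat \<Rightarrow> nat \<Rightarrow> 'b \<Rightarrow> nat" where
  "key i j r \<equiv> n * a i r + a j r"

text \<open>An arbitrary reference order on the rows. It influences each \<open>M i j\<close>, but
  cancels in the sum of two of them, see \<open>M_add\<close>.\<close>

definition base :: "'b \<Rightarrow> nat" where
  "base = (SOME f. inj_on f R)"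

definition M :: "nat \<Rightarrow> nat \<Rightarrow> bit" where
  "M i j = disagreement R base (key i j)"

lemma inj_base: "inj_on base R"
  unfolding base_def using finite_imp_inj_to_nat_seg[OF finite_rows] by (metis someI_ex)

lemma rows_eqI:
  assumes "i \<le> n" "j \<le> n" "i \<noteq> j" "r \<in> R" "s \<in> R" "a i r = a i s" "a j r = a j s"
  shows "r = s"
  using bij[OF assms(1-3)] assms(4-) by (auto simp: bij_betw_def inj_on_def)

lemma key_less_iff:
  assumes "i \<le> n" "j \<le> n" "r \<in> R" "s \<in> R"
  shows "key i j r < key i j s \<longleftrightarrow> a i r < a i s \<or> a i r = a i s \<and> a j r < a j s"
  using assms by (intro lex_less_iff range_less)

lemma inj_key:
  assumes "i \<le> n" "j \<le> n" "i \<noteq> j"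
  shows "inj_on (key i j) R"
proof (rule inj_onI)
  fix r s assume rs: "r \<in> R" "s \<in> R" "key i j r = key i j s"
  then have "\<not> key i j r < key i j s" "\<not> key i j s < key i j r" by simp_all
  then have "a i r = a i s" "a j r = a j s"
    using key_less_iff[OF assms(1,2) rs(1,2)] key_less_iff[OF assms(1,2) rs(2,1)] by auto
  then show "r = s" using rows_eqI assms rs by blast
qed

lemma M_add:
  assumes "i \<le> n" "j \<le> n" "i \<noteq> j" "k \<le> n" "l \<le> n" "k \<noteq> l"
  shows "M i j + M k l = disagreement R (key i j) (key k l)"
  unfolding M_def
  by (subst disagreement_commute[of R base "key i j"])
    (intro disagreement_trans finite_rows inj_base inj_key assms)

text \<open>Rows that differ in column \<open>i\<close> are ordered alike by both keys, so
  disagreements occur only between rows sharing their entry there.\<close>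

lemma M_add_eq_skew:
  assumes "i \<le> n" "j \<le> n" "l \<le> n" "i \<noteq> j" "i \<noteq> l"
  shows "M i j + M i l = of_nat (card (skew_pairs R (a i) (a j) (a l)))"
proof -
  have "{(x, y) \<in> R \<times> R. key i j x < key i j y \<and> key i l y < key i l x} =
      skew_pairs R (a i) (a j) (a l)"
    using assms by (auto simp: skew_pairs_def key_less_iff)
  then show ?thesis
    using M_add[of i j i l] assms by (simp add: disagreement_eq_card finite_rows)
qed

text \<open>Two values for column \<open>i\<close> and two for column \<open>j\<close>, matched in
  opposite order, determine both rows; hence the count is (n choose 2)^2.\<close>

lemma even_opposite_pairs:
  assumes "i \<le> n" "j \<le> n" "i \<noteq> j"
  shows "even (card {(r, s) \<in> R \<times> R. a i r < a i s \<and> a j s < a j r})"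
proof -
  let ?Q = "{(x, y). x < y \<and> y < n}"
  \<comment> \<open>The entries of column \<open>j\<close> are listed in reverse, which makes both
    components increasing.\<close>
  let ?h = "\<lambda>(r, s). ((a i r, a i s), (a j s, a j r))"
  let ?X = "{(r, s) \<in> R \<times> R. a i r < a i s \<and> a j s < a j r}"
  have inj: "inj_on ?h ?X"
    using rows_eqI[OF assms] by (auto simp: inj_on_def)
  have img_h: "?h ` ?X = ?Q \<times> ?Q"
  proof (intro equalityI subsetI)
    fix z assume "z \<in> ?h ` ?X"
    then show "z \<in> ?Q \<times> ?Q" using range_less assms by auto
  next
    fix z assume "z \<in> ?Q \<times> ?Q"
    then obtain p q p' q' where z: "z = ((p, q), (p', q'))" "p < q" "q < n" "p' < q'" "q' < n"
      by auto
    have img: "(\<lambda>r. (a i r, a j r)) ` R = {..<n} \<times> {..<n}"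
      using bij[OF assms] by (simp add: bij_betw_def)
    have "(p, q') \<in> (\<lambda>r. (a i r, a j r)) ` R" "(q, p') \<in> (\<lambda>r. (a i r, a j r)) ` R"
      unfolding img using z by auto
    then obtain r s where "r \<in> R" "s \<in> R" "a i r = p" "a j r = q'" "a i s = q" "a j s = p'"
      by auto
    then show "z \<in> ?h ` ?X" using z by (intro image_eqI[of _ _ "(r, s)"]) auto
  qed
  have "card ?X = card (?Q \<times> ?Q)"
    unfolding img_h[symmetric] by (rule card_image[OF inj, symmetric])
  then show ?thesis
    using even_card_increasing_pairs[OF four_dvd] by (simp add: card_cartesian_product)
qed

text \<open>Rows that agree in one of the two columns are ordered by the other column in both keys,
  so the keys disagree exactly on the pairs of \<open>even_opposite_pairs\<close>.\<close>

lemma M_commute: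
  assumes "i \<le> n" "j \<le> n" "i \<noteq> j"
  shows "M i j = M j i"
proof -
  have "{(x, y) \<in> R \<times> R. key i j x < key i j y \<and> key j i y < key j i x} =
      {(r, s) \<in> R \<times> R. a i r < a i s \<and> a j s < a j r}"
    using assms by (auto simp: key_less_iff)
  then have "M i j + M j i = 0"
    using M_add[of i j j i] even_opposite_pairs[OF assms] assms
    by (auto simp add: disagreement_eq_card finite_rows elim!: evenE)
  then show ?thesis by (cases "M i j"; cases "M j i") auto
qed

lemma card_rows: "card R = n\<^sup>2"
\<comment> \<open>Columns 0 and 1 are both available only for positive \<open>n\<close>.\<close>
proof (cases "n = 0")
  case True
  then have "r \<notin> R" for r using range_less[of 0 r] by auto
  then have "R = {}" by blast
  then show ?thesis using True by simp
next
  case False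
  then show ?thesis using bij_betw_same_card[OF bij[of 0 1]] by (simp add: power2_eq_square)
qed

text \<open>Any second column \<open>i\<close> puts these rows in bijection with its
  \<open>n\<close> possible values.\<close>

lemma card_agreeing:
  assumes "j \<le> n" "r \<in> R"
  shows "card {s \<in> R. a j s = a j r} = n"
proof -
  have "n > 0" using range_less[OF assms] by simp
  then obtain i where i: "i \<le> n" "i \<noteq> j" by (metis le0 le_refl neq0_conv)
  have img: "(\<lambda>s. (a i s, a j s)) ` R = {..<n} \<times> {..<n}"
    using bij[OF i(1) assms(1) i(2)] by (simp add: bij_betw_def)
  have "(\<lambda>s. (a i s, a j s)) ` {s \<in> R. a j s = a j r} =
      (\<lambda>s. (a i s, a j s)) ` R \<inter> UNIV \<times> {a j r}"
    by auto
  also have "\<dots> = {..<n} \<times> {a j r}"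
    unfolding img using range_less[OF assms] by auto
  finally have "bij_betw (\<lambda>s. (a i s, a j s)) {s \<in> R. a j s = a j r} ({..<n} \<times> {a j r})"
    by (intro bij_betw_subset[OF bij[OF i(1) assms(1) i(2)]]) auto
  from bij_betw_same_card[OF this] show ?thesis by simp
qed

text \<open>Each row agrees with \<open>n - 1\<close> others in every one of the \<open>n + 1\<close> columns, which
  accounts for all \<open>n\<^sup>2 - 1\<close> other rows.\<close>

lemma agreeing_column:
  assumes r: "r \<in> R" and s: "s \<in> R" and "r \<noteq> s"
  shows "\<exists>!j. j \<le> n \<and> a j r = a j s"
proof -
  let ?A = "\<lambda>j. {s \<in> R. a j s = a j r} - {r}"
  have n: "n > 0" using range_less[of 0 r] r by auto
  have "card (?A j) = n - 1" if "j \<le> n" for j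
    using card_agreeing[OF that r] r finite_rows by (simp add: card_Diff_singleton)
  \<comment> \<open>The union is disjoint because rows that agree in two columns are equal.\<close>
  moreover have "card (\<Union>j\<in>{..n}. ?A j) = (\<Sum>j\<in>{..n}. card (?A j))"
    by (rule card_UN_disjoint) (use finite_rows r rows_eqI in \<open>auto\<close>)
  ultimately have "card (\<Union>j\<in>{..n}. ?A j) = (n + 1) * (n - 1)" by simp
  also have "\<dots> = card (R - {r})"
    using n r finite_rows by (simp add: card_rows power2_eq_square algebra_simps diff_mult_distrib2)
  finally have "(\<Union>j\<in>{..n}. ?A j) = R - {r}"
    by (intro card_subset_eq) (use finite_rows in auto)
  then have "s \<in> (\<Union>j\<in>{..n}. ?A j)" using s \<open>r \<noteq> s\<close> by simp
  then have "\<exists>j\<le>n. a j r = a j s" by auto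
  then show ?thesis using rows_eqI assms by blast
qed

text \<open>Rows ordered oppositely by \<open>c\<close> and \<open>d\<close> differ in both, so
  their unique column of agreement is one of the others: each such pair is counted for exactly one
  \<open>j\<close>.\<close>

lemma sum_skew_pairs:
  assumes c: "c \<le> n" "d \<le> n" "c \<noteq> d"
  shows "(\<Sum>j\<in>{..n} - {c, d}. card (skew_pairs R (a j) (a c) (a d))) =
    card {(r, s) \<in> R \<times> R. a c r < a c s \<and> a d s < a d r}"
proof -
  let ?X = "{(r, s) \<in> R \<times> R. a c r < a c s \<and> a d s < a d r}"
  have "card (\<Union>j\<in>{..n} - {c, d}. skew_pairs R (a j) (a c) (a d)) =
      (\<Sum>j\<in>{..n} - {c, d}. card (skew_pairs R (a j) (a c) (a d)))"
  proof (intro card_UN_disjoint ballI impI)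
    fix i j assume "i \<in> {..n} - {c, d}" "j \<in> {..n} - {c, d}" "i \<noteq> j"
    then have ij: "i \<le> n" "j \<le> n" "i \<noteq> j" by auto
    have "a c r = a c s" if "r \<in> R" "s \<in> R" "a i r = a i s" "a j r = a j s" for r s
      using rows_eqI[OF ij that] by (rule arg_cong)
    then show "skew_pairs R (a i) (a c) (a d) \<inter> skew_pairs R (a j) (a c) (a d) = {}"
      unfolding skew_pairs_def by (auto dest: less_imp_neq)
  qed (use finite_rows in auto)
  moreover have "(\<Union>j\<in>{..n} - {c, d}. skew_pairs R (a j) (a c) (a d)) = ?X"
  proof (intro equalityI subsetI)
    fix z assume "z \<in> ?X"
    then obtain r s where z: "z = (r, s)" "r \<in> R" "s \<in> R" "a c r < a c s" "a d s < a d r" by auto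
    then obtain j where "j \<le> n" "a j r = a j s" using agreeing_column[of r s] by blast
    then show "z \<in> (\<Union>j\<in>{..n} - {c, d}. skew_pairs R (a j) (a c) (a d))"
      using z by (auto simp: skew_pairs_def intro!: bexI[of _ j])
  qed (auto simp: skew_pairs_def)
  ultimately show ?thesis by simp
qed

text \<open>Degrees agree modulo 2. Without the edge joining \<open>c\<close> and \<open>d\<close>,
  the two sums add up to the number of pairs that \<open>c\<close> and \<open>d\<close> order
  oppositely, which is even; that edge contributes equally to both sides.\<close>

lemma column_sum_eq:
  assumes c: "c \<le> n" "d \<le> n" "c \<noteq> d"
  shows "(\<Sum>j\<in>{..n} - {c}. M j c) = (\<Sum>j\<in>{..n} - {d}. M j d)"
proof -
  let ?V = "{..n} - {c, d}"
  have "(\<Sum>j\<in>?V. M j c) + (\<Sum>j\<in>?V. M j d) =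
      (\<Sum>j\<in>?V. of_nat (card (skew_pairs R (a j) (a c) (a d))))"
    unfolding sum.distrib[symmetric] by (rule sum.cong) (use c in \<open>auto simp: M_add_eq_skew\<close>)
  also have "\<dots> = of_nat (card {(r, s) \<in> R \<times> R. a c r < a c s \<and> a d s < a d r})"
    by (simp only: sum_skew_pairs[OF c, symmetric] of_nat_sum)
  also have "\<dots> = 0" using even_opposite_pairs[OF c] by (auto elim!: evenE)
  finally have "(\<Sum>j\<in>?V. M j c) = (\<Sum>j\<in>?V. M j d)"
    by (cases "\<Sum>j\<in>?V. M j c"; cases "\<Sum>j\<in>?V. M j d") auto
  moreover have "(\<Sum>j\<in>{..n} - {c}. M j c) = M d c + (\<Sum>j\<in>?V. M j c)"
    by (subst sum.remove[of _ d]) (use c in \<open>auto intro!: sum.cong\<close>)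
  moreover have "(\<Sum>j\<in>{..n} - {d}. M j d) = M c d + (\<Sum>j\<in>?V. M j d)"
    by (subst sum.remove[of _ c]) (use c in \<open>auto intro!: sum.cong\<close>)
  ultimately show ?thesis using M_commute[OF c] by metis
qed

text \<open>Handshake argument: the sum of all degrees vanishes in Z_2, and it consists of an odd
  number \<open>n + 1\<close> of equal terms.\<close>

lemma column_sum_zero:
  assumes c: "c \<le> n"
  shows "(\<Sum>j\<in>{..n} - {c}. M j c) = 0"
proof -
  let ?P = "{(x, y). x < y \<and> y \<le> n}"
  let ?S = "{(x, y). y < x \<and> x \<le> n}"
  have fin: "finite ?P" "finite ?S"
    by (rule finite_subset[of _ "{..n} \<times> {..n}"]; auto)+
  have "(\<Sum>d\<in>{..n}. \<Sum>j\<in>{..n} - {d}. M j d) = (\<Sum>d\<in>{..n}. \<Sum>j\<in>{..n} - {c}. M j c)"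
    by (rule sum.cong[OF refl]) (use column_sum_eq c in \<open>metis atMost_iff\<close>)
  also have "\<dots> = of_nat (n + 1) * (\<Sum>j\<in>{..n} - {c}. M j c)" by simp
  also have "of_nat (n + 1) = (1 :: bit)" using four_dvd by (auto elim!: dvdE)
  finally have "(\<Sum>j\<in>{..n} - {c}. M j c) = (\<Sum>d\<in>{..n}. \<Sum>j\<in>{..n} - {d}. M j d)" by simp
  also have "\<dots> = (\<Sum>(d, j)\<in>Sigma {..n} (\<lambda>d. {..n} - {d}). M j d)"
    by (rule sum.Sigma) auto
  also have "Sigma {..n} (\<lambda>d. {..n} - {d}) = ?P \<union> ?S" by auto
  also have "(\<Sum>(d, j)\<in>?P \<union> ?S. M j d) = (\<Sum>(d, j)\<in>?P. M j d) + (\<Sum>(d, j)\<in>?S. M j d)"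
    by (rule sum.union_disjoint) (use fin in auto)
  also have "(\<Sum>(d, j)\<in>?S. M j d) = (\<Sum>(d, j)\<in>?P. M j d)"
    by (rule sum.reindex_bij_witness[where i = prod.swap and j = prod.swap])
      (auto intro: M_commute)
  finally show ?thesis by (simp only: bit_add_self)
qed

end

section \<open>Goodman's count of monochromatic triangles\<close>

definition mixed_pairs :: "nat \<Rightarrow> (nat \<Rightarrow> nat \<Rightarrow> bool) \<Rightarrow> nat \<Rightarrow> (nat \<times> nat) set" where
  "mixed_pairs n G v = {(p, q). p < q \<and> q \<le> n \<and> p \<noteq> v \<and> q \<noteq> v \<and> G p v \<noteq> G q v}"

lemma finite_mixed_pairs [simp]: "finite (mixed_pairs n G v)"
  by (rule finite_subset[of _ "{..n} \<times> {..n}"]) (auto simp: mixed_pairs_def)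

lemma finite_column_triples [simp]: "finite (column_triples k)"
  by (rule finite_subset[of _ "{..<k} \<times> {..<k} \<times> {..<k}"]) (auto simp: column_triples_def)

text \<open>A mixed pair is one of the \<open>d\<close> neighbours of \<open>v\<close> with one of
  the \<open>n - d\<close> other vertices; \<open>?f\<close> puts the neighbour first and
  \<open>?g\<close> sorts the pair again.\<close>

lemma card_mixed_pairs:
  fixes G :: "nat \<Rightarrow> nat \<Rightarrow> bool"
  assumes "v \<le> n"
  defines "d \<equiv> card {j \<in> {..n} - {v}. G j v}"
  shows "card (mixed_pairs n G v) = d * (n - d)"
proof -
  let ?N = "{j \<in> {..n} - {v}. G j v}" and ?N' = "{j \<in> {..n} - {v}. \<not> G j v}"
  let ?f = "\<lambda>(p, q). if G p v then (p, q) else (q, p)"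
  let ?g = "\<lambda>(p, q). if p < q then (p, q) else (q, p :: nat)"
  have "bij_betw ?f (mixed_pairs n G v) (?N \<times> ?N')"
    by (rule bij_betw_byWitness[where f' = ?g])
      (auto simp: mixed_pairs_def not_less_iff_gr_or_eq split: if_splits)
  then have "card (mixed_pairs n G v) = card ?N * card ?N'"
    by (simp add: bij_betw_same_card card_cartesian_product)
  moreover have "card ?N + card ?N' = card ({..n} - {v})"
    by (subst card_Un_disjoint[symmetric]) (auto intro!: arg_cong[of _ _ card])
  then have "card ?N' = n - d" using assms by simp
  ultimately show ?thesis by (simp add: d_def)
qed

text \<open>Goodman's counting argument: a triangle that is not monochromatic has exactly two vertices
  at which its edges differ in colour.\<close>

lemma two_card_mixed_triangles:
  assumes sym: "\<And>i j. i \<le> n \<Longrightarrow> j \<le> n \<Longrightarrow> i \<noteq> j \<Longrightarrow> G i j = G j i"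
  shows "2 * card {(i, j, l) \<in> column_triples (n + 1). \<not> (G i j = G i l \<and> G i l = G j l)} =
    (\<Sum>v\<le>n. card (mixed_pairs n G v))"
proof -
  let ?T = "column_triples (n + 1)"
  \<comment> \<open>Triangles whose edges differ in colour at the first, second and third vertex,
    respectively.\<close>
  let ?A = "{(i, j, l) \<in> ?T. G i j \<noteq> G i l}"
  let ?B = "{(i, j, l) \<in> ?T. G i j \<noteq> G j l}"
  let ?C = "{(i, j, l) \<in> ?T. G i l \<noteq> G j l}"
  \<comment> \<open>The same three sets with the vertex in question moved to the front; they are
    told apart by the position of \<open>v\<close> relative to \<open>p\<close> and
    \<open>q\<close>.\<close>
  let ?A' = "{(v, p, q). v < p \<and> p < q \<and> q \<le> n \<and> G p v \<noteq> G q v}"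
  let ?B' = "{(v, p, q). p < v \<and> v < q \<and> q \<le> n \<and> G p v \<noteq> G q v}"
  let ?C' = "{(v, p, q). p < q \<and> q < v \<and> v \<le> n \<and> G p v \<noteq> G q v}"
  have card_eq: "card {(i, j, l) \<in> ?T. P i j l} = (\<Sum>(i, j, l)\<in>?T. of_bool (P i j l))" for P
    by (simp add: case_prod_unfold sum_of_bool_eq) (auto intro!: arg_cong[of _ _ card])
  have "2 * card {(i, j, l) \<in> ?T. \<not> (G i j = G i l \<and> G i l = G j l)} = card ?A + card ?B + card ?C"
    unfolding card_eq sum_distrib_left sum.distrib[symmetric]
    by (rule sum.cong) auto
  also have "card ?A = card ?A'"
    by (rule arg_cong[of _ _ card]) (use sym in \<open>force simp: column_triples_def\<close>)
  also have "card ?B = card ?B'"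
    by (rule bij_betw_same_card[OF bij_betw_byWitness[where
          f = "\<lambda>(i, j, l). (j, i, l)" and f' = "\<lambda>(j, i, l). (i, j, l)"]])
      (use sym in \<open>force simp: column_triples_def\<close>)+
  also have "card ?C = card ?C'"
    by (rule bij_betw_same_card[OF bij_betw_byWitness[where
          f = "\<lambda>(i, j, l). (l, i, j)" and f' = "\<lambda>(l, i, j). (i, j, l)"]])
      (use sym in \<open>force simp: column_triples_def\<close>)+
  also have "card ?A' + card ?B' + card ?C' = card (?A' \<union> ?B' \<union> ?C')"
  proof -
    have fin: "finite ?A'" "finite ?B'" "finite ?C'"
      by (rule finite_subset[of _ "{..n} \<times> {..n} \<times> {..n}"]; auto)+
    have "card (?A' \<union> ?B' \<union> ?C') = card (?A' \<union> ?B') + card ?C'"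
      by (rule card_Un_disjoint) (use fin in auto)
    also have "card (?A' \<union> ?B') = card ?A' + card ?B'"
      by (rule card_Un_disjoint) (use fin in auto)
    finally show ?thesis by simp
  qed
  also have "?A' \<union> ?B' \<union> ?C' = Sigma {..n} (mixed_pairs n G)"
    by (auto simp: mixed_pairs_def)
  finally show ?thesis by simp
qed

lemma card_increasing_triples: "6 * card (column_triples (n + 1)) = (n + 1) * n * (n - 1)"
proof (induction n)
  case 0
  have "column_triples (0 + 1) = {}" by (auto simp: column_triples_def)
  then show ?case by simp
next
  case (Suc n)
  let ?P = "{(i, j). i < j \<and> j < Suc n}"
  \<comment> \<open>The triples gained in this step are those whose largest column is the new one,
    \<open>Suc n\<close>.\<close>
  let ?E = "(\<lambda>(i, j). (i, j, Suc n)) ` ?P"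
  have fin: "finite ?P" by (rule finite_subset[of _ "{..n} \<times> {..n}"]) auto
  have "column_triples (Suc n + 1) = column_triples (n + 1) \<union> ?E"
    by (auto simp: column_triples_def less_Suc_eq image_iff)
  moreover have "card (column_triples (n + 1) \<union> ?E) = card (column_triples (n + 1)) + card ?E"
  proof (rule card_Un_disjoint)
    show "finite ?E" using fin by (rule finite_imageI)
  next
    show "column_triples (n + 1) \<inter> ?E = {}" by (auto simp: column_triples_def)
  qed simp
  ultimately have "card (column_triples (Suc n + 1)) = card (column_triples (n + 1)) + card ?E"
    by (simp only:)
  also have "card ?E = card ?P"
    by (rule card_image) (auto simp: inj_on_def)
  finally have "6 * card (column_triples (Suc n + 1)) = (n + 1) * n * (n - 1) + 3 * (Suc n * n)"
    using Suc.IH card_increasing_pairs[of "Suc n"] by simp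
  also have "\<dots> = (Suc n + 1) * Suc n * (Suc n - 1)" by (cases n) (simp_all add: algebra_simps)
  finally show ?case .
qed

lemma mono_triangles_bound:
  fixes G :: "nat \<Rightarrow> nat \<Rightarrow> bool"
  assumes sym: "\<And>i j. i \<le> n \<Longrightarrow> j \<le> n \<Longrightarrow> i \<noteq> j \<Longrightarrow> G i j = G j i"
    and n: "4 dvd n"
    and deg: "\<And>v. v \<le> n \<Longrightarrow> even (card {j \<in> {..n} - {v}. G j v})"
  defines "N \<equiv> card {(i, j, l) \<in> column_triples (n + 1). G i j = G i l \<and> G i l = G j l}"
  shows "even N \<and> real N \<ge> real n * (real n + 1) * (real n - 4) / 24"
proof -
  let ?T = "column_triples (n + 1)"
  let ?P = "\<lambda>(i, j, l). G i j = G i l \<and> G i l = G j l"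
  let ?d = "\<lambda>v. card {j \<in> {..n} - {v}. G j v}"
  define K where "K = card {(i, j, l) \<in> ?T. \<not> (G i j = G i l \<and> G i l = G j l)}"
  have NK: "N + K = card ?T"
    unfolding N_def K_def
    by (subst card_Un_disjoint[symmetric])
      (auto intro: finite_subset[OF _ finite_column_triples] intro!: arg_cong[of _ _ card])
  have K: "2 * K = (\<Sum>v\<le>n. ?d v * (n - ?d v))"
  proof -
    have "2 * K = (\<Sum>v\<le>n. card (mixed_pairs n G v))"
      unfolding K_def by (rule two_card_mixed_triangles) (rule sym)
    then show ?thesis by (simp add: card_mixed_pairs)
  qed
  have T: "6 * card ?T = (n + 1) * n * (n - 1)" by (rule card_increasing_triples)
  have "4 dvd ?d v * (n - ?d v)" if "v \<le> n" for v
  proof -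
    have "2 dvd ?d v" "2 dvd n - ?d v"
      using deg[OF that] n by (auto intro: dvd_diff_nat dvd_trans[of 2 4])
    then show ?thesis using mult_dvd_mono by fastforce
  qed
  then have "4 dvd 2 * K" unfolding K by (intro dvd_sum) auto
  then have evenK: "even K" by presburger
  obtain m where m: "n = 4 * m" using n by auto
  have "2 dvd card ?T"
  proof -
    \<comment> \<open>The factor 4 of \<open>n\<close> survives division of
      \<open>6 * card ?T\<close> by 2 as a factor 2, and the remaining 3 is odd.\<close>
    have "(n + 1) * n * (n - 1) = (n + 1) * (4 * m) * (n - 1)" using m by metis
    then have "3 * card ?T = 2 * ((n + 1) * m * (n - 1))" using T by linarith
    then have "even (3 * card ?T)" by simp
    then show ?thesis by simp
  qed
  then have "even N" using NK evenK by (metis even_add)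
  moreover have "real n * (real n + 1) * (real n - 4) / 24 \<le> real N"
  proof -
    have dn: "?d v \<le> n" if "v \<le> n" for v
    proof -
      have "?d v \<le> card ({..n} - {v})" by (rule card_mono) auto
      then show ?thesis using that by simp
    qed
    have "2 * real K = (\<Sum>v\<le>n. real (?d v * (n - ?d v)))"
      using arg_cong[OF K, of real] by simp
    also have "\<dots> \<le> (\<Sum>v\<le>n. (real n)\<^sup>2 / 4)"
    proof (rule sum_mono)
      fix v assume "v \<in> {..n}"
      then have "real (?d v * (n - ?d v)) = real (?d v) * (real n - real (?d v))"
        using dn[of v] by (simp add: of_nat_diff)
      also have "\<dots> \<le> (real n)\<^sup>2 / 4"
        \<comment> \<open>The square of n - 2d is nonnegative, which is the bound of d(n - d) by n^2
          / 4.\<close>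
        using zero_le_power2[of "real n - 2 * real (?d v)"]
        by (simp add: power2_eq_square algebra_simps)
      finally show "real (?d v * (n - ?d v)) \<le> (real n)\<^sup>2 / 4" .
    qed
    finally have "2 * real K \<le> (real n + 1) * ((real n)\<^sup>2 / 4)" by (simp add: add.commute)
    moreover have "6 * (real N + real K) = (real n + 1) * real n * (real n - 1)"
    \<comment> \<open>The truncated \<open>n - 1\<close> matches the real difference only for
      positive \<open>n\<close>.\<close>
    proof (cases "n = 0")
      case True
      then show ?thesis using T NK by simp
    next
      case False
      have "6 * (real N + real K) = real (6 * card ?T)" using NK by simp
      also have "\<dots> = real ((n + 1) * n * (n - 1))" unfolding T ..
      finally show ?thesis using False by (simp add: of_nat_diff algebra_simps)
    qed
    \<comment> \<open>(n + 1)n(n - 1)/6 - (n + 1)n^2/8 equals n(n + 1)(n - 4)/24.\<close>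
    ultimately show ?thesis by (simp add: power2_eq_square field_simps)
  qed
  ultimately show ?thesis ..
qed

section \<open>Parities of the Latin squares in the ensemble\<close>

text \<open>On the rows with \<open>x r = s\<close>, the permutation \<open>g s\<close> sends
  \<open>y r\<close> to \<open>z r\<close>, so its inversions are the pairs of such rows ordered
  oppositely by \<open>y\<close> and \<open>z\<close>. Three assignments of the roles
  \<open>x\<close>, \<open>y\<close>, \<open>z\<close> yield the row-, column- and
  symbol-parity.\<close>

lemma sum_perm_parity_eq_skew:
  fixes x y z :: "'b \<Rightarrow> 'a"
  assumes fin: "finite S" "finite R" and u: "inj_on u S"
    and x: "\<And>r. r \<in> R \<Longrightarrow> x r \<in> S"
    and y: "\<And>s. s \<in> S \<Longrightarrow> bij_betw y {r \<in> R. x r = s} S"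
    and z: "\<And>s. s \<in> S \<Longrightarrow> bij_betw z {r \<in> R. x r = s} S"
    and g: "\<And>r. r \<in> R \<Longrightarrow> g (x r) (y r) = z r"
  shows "(\<Sum>s\<in>S. perm_parity S (g s)) = of_nat (card (skew_pairs R (u \<circ> x) (u \<circ> y) (u \<circ> z)))"
proof -
  let ?R = "\<lambda>s. {r \<in> R. x r = s}"
  let ?X = "\<lambda>s. {(q, r) \<in> ?R s \<times> ?R s. (u \<circ> y) q < (u \<circ> y) r \<and> (u \<circ> z) r < (u \<circ> z) q}"
  have "perm_parity S (g s) = of_nat (card (?X s))" if s: "s \<in> S" for s
  proof -
    \<comment> \<open>On this fibre the composition is \<open>z\<close>, and bijectivity passes to
      \<open>g s\<close> since \<open>y\<close> is bijective there.\<close>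
    have "bij_betw (g s \<circ> y) (?R s) S"
      using z[OF s] by (rule bij_betw_cong[THEN iffD1, rotated]) (use g in auto)
    then have "bij_betw (g s) S S" using bij_betw_comp_iff[OF y[OF s]] by blast
    then have "perm_parity S (g s) = disagreement S u (u \<circ> g s)"
      by (rule perm_parity_eq_disagreement[OF fin(1) u])
    also have "\<dots> = disagreement (?R s) (u \<circ> y) ((u \<circ> g s) \<circ> y)"
      by (rule disagreement_reindex[OF y[OF s], symmetric])
    also have "\<dots> = disagreement (?R s) (u \<circ> y) (u \<circ> z)"
      by (rule disagreement_cong) (use g in auto)
    also have "\<dots> = of_nat (card (?X s))"
      by (rule disagreement_eq_card) (use fin in simp)
    finally show ?thesis .
  qed
  then have "(\<Sum>s\<in>S. perm_parity S (g s)) = of_nat (\<Sum>s\<in>S. card (?X s))"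
    by simp
  also have "(\<Sum>s\<in>S. card (?X s)) = card (\<Union>s\<in>S. ?X s)"
    by (rule card_UN_disjoint[symmetric])
      (use fin in \<open>auto intro: finite_subset[of _ "R \<times> R"]\<close>)
  \<comment> \<open>Injectivity of \<open>u\<close> makes equal numbers \<open>u (x r)\<close> mean
    equal symbols \<open>x r\<close>.\<close>
  also have "(\<Union>s\<in>S. ?X s) = skew_pairs R (u \<circ> x) (u \<circ> y) (u \<circ> z)"
    using x inj_onD[OF u] by (auto simp: skew_pairs_def)
  finally show ?thesis .
qed

lemma orthogonal_array_ex1:
  assumes "orthogonal_array k n \<Lambda> A" "i < k" "j < k" "i \<noteq> j" "x \<in> \<Lambda>" "y \<in> \<Lambda>"
  shows "\<exists>!r. r < n\<^sup>2 \<and> A $$ (r, i) = x \<and> A $$ (r, j) = y"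
  using assms by (simp add: orthogonal_array_def)

lemma orthogonal_array_mem:
  assumes "orthogonal_array k n \<Lambda> A" "r < n\<^sup>2" "i < k"
  shows "A $$ (r, i) \<in> \<Lambda>"
  using assms by (simp add: orthogonal_array_def)

lemma orthogonal_array_bij_fibre:
  assumes A: "orthogonal_array k n \<Lambda> A" and k: "i < k" "j < k" "i \<noteq> j" and x: "x \<in> \<Lambda>"
  shows "bij_betw (\<lambda>r. A $$ (r, j)) {r \<in> {..<n\<^sup>2}. A $$ (r, i) = x} \<Lambda>"
  unfolding bij_betw_def
proof (intro conjI inj_onI equalityI subsetI)
  fix r s
  assume "r \<in> {r \<in> {..<n\<^sup>2}. A $$ (r, i) = x}" "s \<in> {r \<in> {..<n\<^sup>2}. A $$ (r, i) = x}"
    and "A $$ (r, j) = A $$ (s, j)"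
  then show "r = s"
    using orthogonal_array_ex1[OF A k x, of "A $$ (r, j)"] orthogonal_array_mem[OF A, of r j] k
    by auto
next
  fix y assume "y \<in> \<Lambda>"
  then show "y \<in> (\<lambda>r. A $$ (r, j)) ` {r \<in> {..<n\<^sup>2}. A $$ (r, i) = x}"
    using orthogonal_array_ex1[OF A k x, of y] by auto
qed (use orthogonal_array_mem[OF A] k in auto)

lemma orthogonal_array_bij:
  assumes A: "orthogonal_array k n \<Lambda> A" and k: "i < k" "j < k" "i \<noteq> j"
  shows "bij_betw (\<lambda>r. (A $$ (r, i), A $$ (r, j))) {..<n\<^sup>2} (\<Lambda> \<times> \<Lambda>)"
  unfolding bij_betw_def
proof (intro conjI inj_onI equalityI subsetI)
  fix r s
  assume "r \<in> {..<n\<^sup>2}" "s \<in> {..<n\<^sup>2}"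
    and "(A $$ (r, i), A $$ (r, j)) = (A $$ (s, i), A $$ (s, j))"
  moreover from this have "A $$ (r, i) \<in> \<Lambda>" "A $$ (r, j) \<in> \<Lambda>"
    using orthogonal_array_mem[OF A, of s] k by auto
  ultimately show "r = s" using orthogonal_array_ex1[OF A k, of "A $$ (r, i)" "A $$ (r, j)"] by auto
next
  fix z assume "z \<in> \<Lambda> \<times> \<Lambda>"
  then show "z \<in> (\<lambda>r. (A $$ (r, i), A $$ (r, j))) ` {..<n\<^sup>2}"
    using orthogonal_array_ex1[OF A k, of "fst z" "snd z"] by (auto simp: image_iff)
qed (use orthogonal_array_mem[OF A] k in auto)

lemma sum_perm_parity_array:
  assumes A: "orthogonal_array k n \<Lambda> A" and u: "inj_on u \<Lambda>"
    and c: "i < k" "j < k" "l < k" "i \<noteq> j" "i \<noteq> l"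
    and g: "\<And>r. r < n\<^sup>2 \<Longrightarrow> g (A $$ (r, i)) (A $$ (r, j)) = A $$ (r, l)"
  shows "(\<Sum>x\<in>\<Lambda>. perm_parity \<Lambda> (g x)) = of_nat (card (skew_pairs {..<n\<^sup>2}
    (\<lambda>r. u (A $$ (r, i))) (\<lambda>r. u (A $$ (r, j))) (\<lambda>r. u (A $$ (r, l)))))"
proof -
  have "finite \<Lambda>" using A by (simp add: orthogonal_array_def)
  from sum_perm_parity_eq_skew[OF this finite_lessThan u, where
      x = "\<lambda>r. A $$ (r, i)" and y = "\<lambda>r. A $$ (r, j)" and z = "\<lambda>r. A $$ (r, l)" and g = g]
  show ?thesis
    using orthogonal_array_mem[OF A] orthogonal_array_bij_fibre[OF A] c g
    by (simp add: comp_def)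
qed

lemma ensemble_parities:
  assumes A: "orthogonal_array k n \<Lambda> A" and u: "inj_on u \<Lambda>" and t: "(i, j, l) \<in> column_triples k"
  defines "a \<equiv> \<lambda>i r. u (A $$ (r, i))"
  shows "row_parity \<Lambda> (ensemble A (i, j, l)) = of_nat (card (skew_pairs {..<n\<^sup>2} (a i) (a j) (a l)))"
    and "column_parity \<Lambda> (ensemble A (i, j, l)) = of_nat (card (skew_pairs {..<n\<^sup>2} (a j) (a i) (a l)))"
    and "symbol_parity \<Lambda> (ensemble A (i, j, l)) = of_nat (card (skew_pairs {..<n\<^sup>2} (a l) (a i) (a j)))"
proof -
  let ?L = "ensemble A (i, j, l)"
  have k: "i < k" "j < k" "l < k" "i \<noteq> j" "i \<noteq> l" "j \<noteq> l"
    using t by (auto simp: column_triples_def)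
  note L = ensemble_entry[OF A t]
  show "row_parity \<Lambda> ?L = of_nat (card (skew_pairs {..<n\<^sup>2} (a i) (a j) (a l)))"
    unfolding row_parity_def a_def by (rule sum_perm_parity_array[OF A u]) (use k L in auto)
  show "column_parity \<Lambda> ?L = of_nat (card (skew_pairs {..<n\<^sup>2} (a j) (a i) (a l)))"
    unfolding column_parity_def a_def by (rule sum_perm_parity_array[OF A u]) (use k L in auto)
  \<comment> \<open>The permutation of a fixed symbol takes the entry of column \<open>i\<close> to
    that of column \<open>j\<close>; the position is unique because each row of the square is
    injective.\<close>
  have "(THE y. y \<in> \<Lambda> \<and> ?L (A $$ (r, i)) y = A $$ (r, l)) = A $$ (r, j)" if r: "r < n\<^sup>2" for r
  proof (rule the_equality)
    show "A $$ (r, j) \<in> \<Lambda> \<and> ?L (A $$ (r, i)) (A $$ (r, j)) = A $$ (r, l)"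
      using L[OF r] orthogonal_array_mem[OF A r] k by simp
  next
    fix y assume y: "y \<in> \<Lambda> \<and> ?L (A $$ (r, i)) y = A $$ (r, l)"
    have "inj_on (?L (A $$ (r, i))) \<Lambda>"
      using latin_square_ensemble[OF A t] orthogonal_array_mem[OF A r] k
      by (simp add: latin_square_def bij_betw_def)
    moreover have "?L (A $$ (r, i)) y = ?L (A $$ (r, i)) (A $$ (r, j))"
      using y L[OF r] by simp
    ultimately show "y = A $$ (r, j)"
      using y orthogonal_array_mem[OF A r] k by (blast dest: inj_onD)
  qed
  then show "symbol_parity \<Lambda> ?L = of_nat (card (skew_pairs {..<n\<^sup>2} (a l) (a i) (a j)))"
    unfolding symbol_parity_def a_def by (intro sum_perm_parity_array[OF A u]) (use k in auto)
qed

theorem theorem6p3: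
  fixes n :: nat and \<Lambda> :: "'a set" and A :: "'a mat"
  assumes "n \<ge> 2" and "[n = 0] (mod 4)"
    and "orthogonal_array (n + 1) n \<Lambda> A"
  defines "N \<equiv> card {t \<in> column_triples (n + 1).
                       latin_square \<Lambda> (ensemble A t) \<and> equiparity \<Lambda> (ensemble A t)}"
  shows "even N \<and> real N \<ge> real n * (real n + 1) * (real n - 4) / 24"
proof -
  have fin: "finite \<Lambda>" and card: "card \<Lambda> = n" and n4: "4 dvd n"
    using assms(2,3) by (auto simp: orthogonal_array_def cong_0_iff)
  \<comment> \<open>One numbering of the alphabet both renames the symbols for the locale and counts
    the inversions in the parities.\<close>
  obtain u where u: "bij_betw u \<Lambda> {..<n}"
    using ex_bij_betw_finite_nat[OF fin] by (auto simp: card lessThan_atLeast0)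
  then have inj: "inj_on u \<Lambda>" by (rule bij_betw_imp_inj_on)
  define a where "a = (\<lambda>i r. u (A $$ (r, i)))"
  have a_eq: "(\<lambda>r. u (A $$ (r, i))) = a i" for i by (simp add: a_def)
  interpret column_array n "{..<n\<^sup>2}" a
  proof
    fix i j assume ij: "i \<le> n" "j \<le> n" "i \<noteq> j"
    have "bij_betw (map_prod u u \<circ> (\<lambda>r. (A $$ (r, i), A $$ (r, j)))) {..<n\<^sup>2} ({..<n} \<times> {..<n})"
      using ij by (intro bij_betw_trans[OF orthogonal_array_bij[OF assms(3)] bij_betw_map_prod[OF u u]])
        auto
    then show "bij_betw (\<lambda>r. (a i r, a j r)) {..<n\<^sup>2} ({..<n} \<times> {..<n})"
      by (simp add: a_def comp_def)
  next
    fix i r assume "i \<le> n" "r \<in> {..<n\<^sup>2}"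
    then show "a i r < n"
      using orthogonal_array_mem[OF assms(3), of r i] bij_betwE[OF u] by (simp add: a_def)
  qed (use n4 in auto)
  let ?G = "\<lambda>i j. M i j = 1"
  have deg: "even (card {j \<in> {..n} - {v}. ?G j v})" if "v \<le> n" for v
  proof -
    \<comment> \<open>A sum in Z_2 is the number of its nonzero terms modulo 2, here the degree of
      \<open>v\<close>.\<close>
    have "(\<Sum>j\<in>{..n} - {v}. M j v) = (\<Sum>j\<in>{j \<in> {..n} - {v}. ?G j v}. 1)"
      by (rule sum.mono_neutral_cong_right) auto
    then have "of_nat (card {j \<in> {..n} - {v}. ?G j v}) = (0 :: bit)"
      using column_sum_zero[OF that] by simp
    then show ?thesis by (metis even_of_nat_iff even_zero)
  qed
  have "equiparity \<Lambda> (ensemble A (i, j, l)) \<longleftrightarrow> ?G i j = ?G i l \<and> ?G i l = ?G j l"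
    if t: "(i, j, l) \<in> column_triples (n + 1)" for i j l
  proof -
    have k: "i \<le> n" "j \<le> n" "l \<le> n" "i \<noteq> j" "i \<noteq> l" "j \<noteq> l"
      using t by (auto simp: column_triples_def)
    note parities = ensemble_parities[OF assms(3) inj t, unfolded a_eq]
    have "row_parity \<Lambda> (ensemble A (i, j, l)) = M i j + M i l"
      using parities(1) M_add_eq_skew[of i j l] k by simp
    moreover have "column_parity \<Lambda> (ensemble A (i, j, l)) = M i j + M j l"
      using parities(2) M_add_eq_skew[of j i l] M_commute[of i j] k by simp
    moreover have "symbol_parity \<Lambda> (ensemble A (i, j, l)) = M i l + M j l"
      using parities(3) M_add_eq_skew[of l i j] M_commute[of i l] M_commute[of j l] k by simp
    \<comment> \<open>Each two of the three parities share one edge of the triangle; cancelling it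
      turns their equality into equality of the other two edges.\<close>
    ultimately show ?thesis
      unfolding equiparity_def by (cases "M i j"; cases "M i l"; cases "M j l") auto
  qed
  then have "N = card {(i, j, l) \<in> column_triples (n + 1). ?G i j = ?G i l \<and> ?G i l = ?G j l}"
    unfolding N_def
    by (intro arg_cong[of _ _ card]) (auto intro: latin_square_ensemble[OF assms(3)])
  moreover have "?G i j = ?G j i" if "i \<le> n" "j \<le> n" "i \<noteq> j" for i j
    using M_commute[OF that] by simp
  ultimately show ?thesis
    using mono_triangles_bound[of n ?G, OF _ n4 deg] by simp
qed

end
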